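(* Let $F$ be an algebraically closed field of characteristic zero, $G$ a finite group, and $A$ a finite dimensional $G$-simple $F$-algebra with presentation $P_A=(H,\alpha,\mathfrak g)$. Suppose $H$ is normal in $G$ and the cosets of $H$ in $G$ are equally represented in $\mathfrak g$. If $\alpha\in H^2(H,F^* )$ is trivial then $A$ is $G$-graded strongly verbally prime.
   Context: $F\langle X_G\rangle$ is the free associative algebra on $X_G=\{x_{i,g}: i\in\mathbb N, g\in G\}$, $G$-graded by letting $x_{i_1,g_1}\cdots x_{i_n,g_n}$ have degree $g_1\cdots g_n$; a polynomial is $G$-homogeneous if it lies in one homogeneous component. For a $G$-graded algebra $A=\oplus_{g\in G}A_g$, $Id_G(A)$ is the set of polynomials vanishing under all substitutions of the variables $x_{i,g}$ by elements of $A_g$. $A$ (PI as an ungraded algebra) is $G$-graded strongly verbally prime if for any $G$-homogeneous $f,g$ defined on disjoint sets of variables with $fg\in Id_G(A)$, either $f\in Id_G(A)$ or $g\in Id_G(A)$. A $G$-graded algebra is $G$-simple if its multiplication is nonzero and it has no nontrivial $G$-graded two-sided ideals. For a subgroup $H\le G$, a 2-cocycle $c\in Z^2(H,F^* )$ (trivial action) and $\mathfrak g=(g_1,\ldots,g_m)\in G^m$, let $F^cH$ be the twisted group algebra with basis $\{u_h\}_{h\in H}$, $u_hu_{h'}=c(h,h')u_{hh'}$, and grade $F^cH\otimes M_m(F)$ by $A_g=\mathrm{span}_F\{u_h\otimes e_{i,j}: g=g_i^{-1}hg_j\}$. Every finite dimensional $G$-simple $F$-algebra is $G$-graded isomorphic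 to such an algebra (Bahturin–Sehgal–Zaicev), and one says that $P_A=(H,[c],\mathfrak g)$ is a presentation of $A$. The cosets of $H$ are equally represented in $\mathfrak g$ if the number of indices $i$ with $g_i\in Hg$ is the same for every right coset $Hg$. *)

theory Defs
  imports
    "HOL-Computational_Algebra.Polynomial"
    "HOL-Library.Poly_Mapping"
    "HOL-Algebra.Coset"
begin

text \<open>
  Noncommutative monomials are wrapped lists, written additively only because
  the convolution product of the library's finitely supported functions expects
  \<^class>\<open>monoid_add\<close> keys.  The type \<open>('x, 'f) free_poly\<close> is then the free unital
  associative algebra on the variables \<open>'x\<close>, and its product is the ring multiplication.
\<close>

datatype 'x free_word = Word (letters: "'x list")

instantiation free_word :: (type) monoid_add
begin

definition zero_free_word :: "'a free_word" where
  "0 = Word []"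

definition plus_free_word :: "'a free_word \<Rightarrow> 'a free_word \<Rightarrow> 'a free_word" where
  "u + v = Word (letters u @ letters v)"

instance
  by standard (simp_all add: zero_free_word_def plus_free_word_def)

end

type_synonym ('x, 'f) free_poly = "'x free_word \<Rightarrow>\<^sub>0 'f"

definition poly_vars :: "('x, 'f::zero) free_poly \<Rightarrow> 'x set" where
  "poly_vars f = (\<Union>w\<in>Poly_Mapping.keys f. set (letters w))"

text \<open>Algebras are associative, but not assumed to have a unit.\<close>

locale assoc_algebra = vector_space scale
  for scale :: "'f::field \<Rightarrow> 'a::ring \<Rightarrow> 'a" +
  assumes scale_mult_left: "scale s x * y = scale s (x * y)"
    and scale_mult_right: "x * scale s y = scale s (x * y)"

definition finite_dimensional :: "('f::field \<Rightarrow> 'a::ab_group_add \<Rightarrow> 'a) \<Rightarrow> bool" where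
  "finite_dimensional scale \<longleftrightarrow> (\<exists>B. finite B \<and> module.span scale B = UNIV)"

text \<open>
  As \<open>'a\<close> need not have a unit, polynomials are evaluated in the unitization
  \<open>F \<oplus> 'a\<close>: the constant term is the first component, and the monomials of positive
  length contribute to the second (so the empty word contributes \<open>0\<close> there).
  For algebras with a unit this gives the usual notion of identity; see
  \<open>identity_unital_iff\<close> below.
\<close>

fun eval_letters :: "('x \<Rightarrow> 'a::ring) \<Rightarrow> 'x list \<Rightarrow> 'a" where
  "eval_letters \<phi> [] = 0"
| "eval_letters \<phi> [x] = \<phi> x"
| "eval_letters \<phi> (x # y # w) = \<phi> x * eval_letters \<phi> (y # w)"

definition eval_poly ::
    "('f::field \<Rightarrow> 'a::ring \<Rightarrow> 'a) \<Rightarrow> ('x \<Rightarrow> 'a) \<Rightarrow> ('x, 'f) free_poly \<Rightarrow> 'f \<times> 'a" where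
  "eval_poly scale \<phi> f =
     (Poly_Mapping.lookup f 0,
      \<Sum>w\<in>Poly_Mapping.keys f. scale (Poly_Mapping.lookup f w) (eval_letters \<phi> (letters w)))"

definition PI_algebra :: "('f::field \<Rightarrow> 'a::ring \<Rightarrow> 'a) \<Rightarrow> bool" where
  "PI_algebra scale \<longleftrightarrow>
     (\<exists>f :: (nat, 'f) free_poly. f \<noteq> 0 \<and> (\<forall>\<phi>. eval_poly scale \<phi> f = (0, 0)))"

lemma eval_letters_unital:
  fixes \<phi> :: "'x \<Rightarrow> 'a::ring_1"
  shows "w \<noteq> [] \<Longrightarrow> eval_letters \<phi> w = prod_list (map \<phi> w)"
  by (induction \<phi> w rule: eval_letters.induct) auto

lemma identity_unital_iff:
  fixes scale :: "'f::field \<Rightarrow> 'a::ring_1 \<Rightarrow> 'a" and f :: "('x, 'f) free_poly"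
  assumes "assoc_algebra scale" and zero: "(\<lambda>x. 0) \<in> S"
  shows "(\<forall>\<phi>\<in>S. eval_poly scale \<phi> f = (0, 0)) \<longleftrightarrow>
         (\<forall>\<phi>\<in>S. (\<Sum>w\<in>Poly_Mapping.keys f. scale (Poly_Mapping.lookup f w) (prod_list (map \<phi> (letters w)))) = 0)"
proof -
  interpret assoc_algebra scale by fact
  have split: "(\<Sum>w\<in>Poly_Mapping.keys f. scale (Poly_Mapping.lookup f w) (prod_list (map \<phi> (letters w)))) =
      scale (Poly_Mapping.lookup f 0) 1 + snd (eval_poly scale \<phi> f)" for \<phi>
  proof -
    have "(\<Sum>w\<in>Poly_Mapping.keys f. scale (Poly_Mapping.lookup f w) (prod_list (map \<phi> (letters w)))) =
        (\<Sum>w\<in>Poly_Mapping.keys f. (if w = 0 then scale (Poly_Mapping.lookup f 0) 1 else 0)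
                    + scale (Poly_Mapping.lookup f w) (eval_letters \<phi> (letters w)))"
    proof (rule sum.cong)
      fix w
      show "scale (Poly_Mapping.lookup f w) (prod_list (map \<phi> (letters w))) =
          (if w = 0 then scale (Poly_Mapping.lookup f 0) 1 else 0)
            + scale (Poly_Mapping.lookup f w) (eval_letters \<phi> (letters w))"
        by (cases w) (auto simp: zero_free_word_def eval_letters_unital)
    qed simp
    also have "\<dots> = scale (Poly_Mapping.lookup f 0) 1 + snd (eval_poly scale \<phi> f)"
      by (auto simp: sum.distrib eval_poly_def in_keys_iff)
    finally show ?thesis .
  qed
  have "eval_letters (\<lambda>x. 0 :: 'a) w = 0" for w :: "'x list"
    by (induction "\<lambda>x::'x. 0::'a" w rule: eval_letters.induct) auto
  then have snd0: "snd (eval_poly scale (\<lambda>x. 0) f) = 0"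
    by (simp add: eval_poly_def)
  have fst: "fst (eval_poly scale \<phi> f) = Poly_Mapping.lookup f 0" for \<phi>
    by (simp add: eval_poly_def)
  show ?thesis
  proof
    assume "\<forall>\<phi>\<in>S. eval_poly scale \<phi> f = (0, 0)"
    moreover from this zero have "Poly_Mapping.lookup f 0 = 0"
      using fst[of "\<lambda>x. 0"] by simp
    ultimately show "\<forall>\<phi>\<in>S. (\<Sum>w\<in>Poly_Mapping.keys f.
        scale (Poly_Mapping.lookup f w) (prod_list (map \<phi> (letters w)))) = 0"
      unfolding split by simp
  next
    assume *: "\<forall>\<phi>\<in>S. (\<Sum>w\<in>Poly_Mapping.keys f.
        scale (Poly_Mapping.lookup f w) (prod_list (map \<phi> (letters w)))) = 0"
    then have "scale (Poly_Mapping.lookup f 0) 1 = 0"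
      using zero snd0 unfolding split by force
    then have "Poly_Mapping.lookup f 0 = 0"
      by simp
    with * show "\<forall>\<phi>\<in>S. eval_poly scale \<phi> f = (0, 0)"
      unfolding split by (simp add: prod_eq_iff fst)
  qed
qed

locale graded_algebra = group G + assoc_algebra scale
  for G (structure)
    and scale :: "'f::field \<Rightarrow> 'a::ring \<Rightarrow> 'a"
    and A :: "'g \<Rightarrow> 'a set" +
  assumes comp_subspace: "g \<in> carrier G \<Longrightarrow> subspace (A g)"
    and direct_sum:
      "\<exists>!d. (\<forall>g\<in>carrier G. d g \<in> A g) \<and> (\<forall>g. g \<notin> carrier G \<longrightarrow> d g = 0)
            \<and> finite {g. d g \<noteq> 0} \<and> x = (\<Sum>g | d g \<noteq> 0. d g)"
    and comp_mult:
      "\<lbrakk>g \<in> carrier G; h \<in> carrier G; x \<in> A g; y \<in> A h\<rbrakk> \<Longrightarrow> x * y \<in> A (g \<otimes> h)"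

definition graded_ideal ::
    "('g, 'b) monoid_scheme \<Rightarrow> ('f::field \<Rightarrow> 'a::ring \<Rightarrow> 'a) \<Rightarrow> ('g \<Rightarrow> 'a set) \<Rightarrow> 'a set \<Rightarrow> bool" where
  "graded_ideal G scale A I \<longleftrightarrow>
     module.subspace scale I \<and> (\<forall>x\<in>I. \<forall>a. a * x \<in> I \<and> x * a \<in> I)
     \<and> I = module.span scale (\<Union>g\<in>carrier G. I \<inter> A g)"

definition graded_simple ::
    "('g, 'b) monoid_scheme \<Rightarrow> ('f::field \<Rightarrow> 'a::ring \<Rightarrow> 'a) \<Rightarrow> ('g \<Rightarrow> 'a set) \<Rightarrow> bool" where
  "graded_simple G scale A \<longleftrightarrow>
     (\<exists>x y :: 'a. x * y \<noteq> 0) \<and> (\<forall>I. graded_ideal G scale A I \<longrightarrow> I = {0} \<or> I = UNIV)"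

text \<open>The variable \<open>x\<^bsub>i,g\<^esub>\<close> is the pair \<open>(i, g)\<close>.\<close>

definition graded_polys :: "('g, 'b) monoid_scheme \<Rightarrow> (nat \<times> 'g, 'f::zero) free_poly set" where
  "graded_polys G = {f. poly_vars f \<subseteq> UNIV \<times> carrier G}"

definition word_degree :: "('g, 'b) monoid_scheme \<Rightarrow> (nat \<times> 'g) free_word \<Rightarrow> 'g" where
  "word_degree G w = foldr (\<lambda>(i, g) h. g \<otimes>\<^bsub>G\<^esub> h) (letters w) \<one>\<^bsub>G\<^esub>"

definition homogeneous_poly ::
    "('g, 'b) monoid_scheme \<Rightarrow> (nat \<times> 'g, 'f::zero) free_poly \<Rightarrow> bool" where
  "homogeneous_poly G f \<longleftrightarrow> (\<exists>g\<in>carrier G. \<forall>w\<in>Poly_Mapping.keys f. word_degree G w = g)"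

definition graded_identities ::
    "('g, 'b) monoid_scheme \<Rightarrow> ('f::field \<Rightarrow> 'a::ring \<Rightarrow> 'a) \<Rightarrow> ('g \<Rightarrow> 'a set)
      \<Rightarrow> (nat \<times> 'g, 'f) free_poly set" where
  "graded_identities G scale A =
     {f \<in> graded_polys G.
        \<forall>\<phi>. (\<forall>i. \<forall>g\<in>carrier G. \<phi> (i, g) \<in> A g) \<longrightarrow> eval_poly scale \<phi> f = (0, 0)}"

definition graded_strongly_verbally_prime ::
    "('g, 'b) monoid_scheme \<Rightarrow> ('f::field \<Rightarrow> 'a::ring \<Rightarrow> 'a) \<Rightarrow> ('g \<Rightarrow> 'a set) \<Rightarrow> bool" where
  "graded_strongly_verbally_prime G scale A \<longleftrightarrow>
     PI_algebra scale \<and>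
     (\<forall>p \<in> graded_polys G. \<forall>q \<in> graded_polys G.
        homogeneous_poly G p \<and> homogeneous_poly G q \<and> poly_vars p \<inter> poly_vars q = {}
        \<and> p * q \<in> graded_identities G scale A
        \<longrightarrow> p \<in> graded_identities G scale A \<or> q \<in> graded_identities G scale A)"

text \<open>
  Trivial action; cocycles of a group \<open>K\<close> with values in \<open>F\<^sup>*\<close> are functions on
  \<open>carrier K \<times> carrier K\<close>, made total by extensionality.
\<close>

definition cocycles2 :: "('g, 'b) monoid_scheme \<Rightarrow> ('g \<times> 'g \<Rightarrow> 'f::field) monoid" where
  "cocycles2 K =
     \<lparr>carrier = {c \<in> carrier K \<times> carrier K \<rightarrow>\<^sub>E - {0}.
        \<forall>x\<in>carrier K. \<forall>y\<in>carrier K. \<forall>z\<in>carrier K.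
          c (x, y) * c (x \<otimes>\<^bsub>K\<^esub> y, z) = c (y, z) * c (x, y \<otimes>\<^bsub>K\<^esub> z)},
      monoid.mult = (\<lambda>c d. \<lambda>p\<in>carrier K \<times> carrier K. c p * d p),
      one = (\<lambda>p\<in>carrier K \<times> carrier K. 1)\<rparr>"

definition coboundaries2 :: "('g, 'b) monoid_scheme \<Rightarrow> ('g \<times> 'g \<Rightarrow> 'f::field) set" where
  "coboundaries2 K =
     {\<lambda>(x, y)\<in>carrier K \<times> carrier K. l x * l y / l (x \<otimes>\<^bsub>K\<^esub> y) | l. \<forall>x\<in>carrier K. l x \<noteq> 0}"

definition cohomology2 :: "('g, 'b) monoid_scheme \<Rightarrow> ('g \<times> 'g \<Rightarrow> 'f::field) set monoid" where
  "cohomology2 K = cocycles2 K Mod coboundaries2 K"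

definition cohomology_class ::
    "('g, 'b) monoid_scheme \<Rightarrow> ('g \<times> 'g \<Rightarrow> 'f::field) \<Rightarrow> ('g \<times> 'g \<Rightarrow> 'f) set" where
  "cohomology_class K c = coboundaries2 K #>\<^bsub>cocycles2 K\<^esub> c"

text \<open>
  An element of \<open>F\<^sup>cH \<otimes> M\<^sub>m(F)\<close> is the finitely supported function of its coordinates in the basis
  \<open>u\<^sub>h \<otimes> e\<^sub>i\<^sub>j\<close>, indexed by \<open>(h, i, j)\<close> with \<open>i, j < m\<close>.  The tuple of group elements
  is a list \<open>gs\<close>, and \<open>m = length gs\<close>.  A homogeneous component is the span of the
  basis vectors \<open>u\<^sub>h \<otimes> e\<^sub>i\<^sub>j\<close> of that degree.
\<close>

definition tm_carrier :: "'g set \<Rightarrow> nat \<Rightarrow> ('g \<times> nat \<times> nat \<Rightarrow>\<^sub>0 'f::zero) set" where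
  "tm_carrier H m = {a. Poly_Mapping.keys a \<subseteq> H \<times> {..<m} \<times> {..<m}}"

definition tm_scale ::
    "'f::field \<Rightarrow> ('g \<times> nat \<times> nat \<Rightarrow>\<^sub>0 'f) \<Rightarrow> ('g \<times> nat \<times> nat \<Rightarrow>\<^sub>0 'f)" where
  "tm_scale s a = Poly_Mapping.map ((*) s) a"

definition tm_mult ::
    "('g, 'b) monoid_scheme \<Rightarrow> ('g \<times> 'g \<Rightarrow> 'f::field)
      \<Rightarrow> ('g \<times> nat \<times> nat \<Rightarrow>\<^sub>0 'f) \<Rightarrow> ('g \<times> nat \<times> nat \<Rightarrow>\<^sub>0 'f) \<Rightarrow> ('g \<times> nat \<times> nat \<Rightarrow>\<^sub>0 'f)" where
  "tm_mult G c a b =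
     (\<Sum>(h, i, j)\<in>Poly_Mapping.keys a. \<Sum>(h', k, l)\<in>Poly_Mapping.keys b.
        if j = k
        then Poly_Mapping.single (h \<otimes>\<^bsub>G\<^esub> h', i, l)
               (c (h, h') * Poly_Mapping.lookup a (h, i, j) * Poly_Mapping.lookup b (h', k, l))
        else 0)"

definition tm_component ::
    "('g, 'b) monoid_scheme \<Rightarrow> 'g set \<Rightarrow> 'g list \<Rightarrow> 'g \<Rightarrow> ('g \<times> nat \<times> nat \<Rightarrow>\<^sub>0 'f::zero) set" where
  "tm_component G H gs g =
     {a \<in> tm_carrier H (length gs).
        \<forall>(h, i, j)\<in>Poly_Mapping.keys a. g = inv\<^bsub>G\<^esub> (gs ! i) \<otimes>\<^bsub>G\<^esub> h \<otimes>\<^bsub>G\<^esub> gs ! j}"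

definition graded_iso_tm ::
    "('g, 'b) monoid_scheme \<Rightarrow> ('f::field \<Rightarrow> 'a::ring \<Rightarrow> 'a) \<Rightarrow> ('g \<Rightarrow> 'a set)
      \<Rightarrow> 'g set \<Rightarrow> ('g \<times> 'g \<Rightarrow> 'f) \<Rightarrow> 'g list \<Rightarrow> ('a \<Rightarrow> ('g \<times> nat \<times> nat \<Rightarrow>\<^sub>0 'f)) \<Rightarrow> bool" where
  "graded_iso_tm G scale A H c gs \<theta> \<longleftrightarrow>
     Vector_Spaces.linear scale tm_scale \<theta>
     \<and> bij_betw \<theta> UNIV (tm_carrier H (length gs))
     \<and> (\<forall>x y. \<theta> (x * y) = tm_mult G c (\<theta> x) (\<theta> y))
     \<and> (\<forall>g\<in>carrier G. \<theta> ` A g = tm_component G H gs g)"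

definition presentation ::
    "('g, 'b) monoid_scheme \<Rightarrow> ('f::field \<Rightarrow> 'a::ring \<Rightarrow> 'a) \<Rightarrow> ('g \<Rightarrow> 'a set)
      \<Rightarrow> 'g set \<Rightarrow> ('g \<times> 'g \<Rightarrow> 'f) set \<Rightarrow> 'g list \<Rightarrow> bool" where
  "presentation G scale A H \<alpha> gs \<longleftrightarrow>
     subgroup H G \<and> set gs \<subseteq> carrier G
     \<and> (\<exists>c \<in> carrier (cocycles2 (G\<lparr>carrier := H\<rparr>)).
          \<alpha> = cohomology_class (G\<lparr>carrier := H\<rparr>) c \<and> (\<exists>\<theta>. graded_iso_tm G scale A H c gs \<theta>))"

definition cosets_equally_represented ::
    "('g, 'b) monoid_scheme \<Rightarrow> 'g set \<Rightarrow> 'g list \<Rightarrow> bool" where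
  "cosets_equally_represented G H gs \<longleftrightarrow>
     (\<forall>C \<in> rcosets\<^bsub>G\<^esub> H. \<forall>D \<in> rcosets\<^bsub>G\<^esub> H.
        card {i. i < length gs \<and> gs ! i \<in> C} = card {i. i < length gs \<and> gs ! i \<in> D})"

end

theory Submission
  imports Defs "HOL-Library.Product_Plus" "HOL-Combinatorics.Permutations"
begin

text \<open>
  Since the class is trivial, the cocycle has the form \<open>c (x, y) = l x * l y / l (x y)\<close>, and
  \<open>u\<^sub>h \<mapsto> l h\<close> is a character of the twisted group algebra.  Applied entrywise it gives an
  algebra homomorphism \<open>\<rho>\<close> from \<open>A\<close> to the \<open>m \<times> m\<close> matrices.  It need not be injective, but it is
  injective on each homogeneous component, because the degree \<open>g\<close> and the position \<open>(i, j)\<close>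
  determine the group element \<open>h = g\<^sub>i g g\<^sub>j\<^sup>-\<^sup>1\<close>; and it maps \<open>A g\<close> onto all matrices supported
  on the pattern of those \<open>(i, j)\<close> with \<open>g\<^sub>i g g\<^sub>j\<^sup>-\<^sup>1 \<in> H\<close>.

  These patterns have many symmetries.  As \<open>H\<close> is normal, left translation by an element \<open>d\<close> of
  \<open>G\<close> permutes the cosets of \<open>H\<close> and preserves every pattern; as the cosets are equally
  represented, it is realised by a permutation of the indices.  These permutations act
  transitively on indices (\<open>coset_permutation\<close>), and diagonal matrices preserve all patterns as
  well.  Hence conjugating the matrices of a graded substitution by an invertible monomial
  matrix gives another graded substitution, whose effect on the value of every polynomial is the
  same conjugation (\<open>eval_poly_conjugate\<close>).

  Now let \<open>p\<close>, \<open>q\<close> be homogeneous without constant term, with nonzero values \<open>a\<close>, \<open>b\<close>.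
  Both matrices \<open>\<rho> a\<close>, \<open>\<rho> b\<close> have nonzero entries, say at \<open>(i, j)\<close> and \<open>(k, n)\<close>.
  A permutation moving \<open>j\<close> to \<open>k\<close> makes the two entries meet in the product, and a
  diagonal factor, chosen among two, prevents the sum they meet in from cancelling
  (\<open>conjugate_value_mult_nonzero\<close>).  As \<open>p\<close> and \<open>q\<close> have no common variable, their substitutions
  can be combined, so \<open>p * q\<close> is not an identity.  Constant terms are dealt with by the zero
  substitution.  Finally \<open>A\<close> satisfies the standard identity of degree exceeding its dimension.
\<close>

section \<open>Evaluation of noncommutative polynomials\<close>

lemma poly_mapping_eq_sum_single:
  "p = (\<Sum>w\<in>Poly_Mapping.keys p. Poly_Mapping.single w (Poly_Mapping.lookup p w))"
  by (rule poly_mapping_eqI) (auto simp: lookup_sum lookup_single when_def in_keys_iff)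

lemma mult_eq_sum_single:
  fixes p q :: "'w::monoid_add \<Rightarrow>\<^sub>0 'f::semiring_0"
  shows "p * q = (\<Sum>u\<in>Poly_Mapping.keys p. \<Sum>v\<in>Poly_Mapping.keys q.
    Poly_Mapping.single (u + v) (Poly_Mapping.lookup p u * Poly_Mapping.lookup q v))"
  by (subst poly_mapping_eq_sum_single[of p], subst poly_mapping_eq_sum_single[of q])
    (simp add: sum_distrib_left sum_distrib_right mult_single
      sum.swap[of _ "Poly_Mapping.keys q"])

lemma lookup_mult_zero_word:
  fixes p q :: "('x, 'f::semiring_0) free_poly"
  shows "Poly_Mapping.lookup (p * q) 0 = Poly_Mapping.lookup p 0 * Poly_Mapping.lookup q 0"
proof -
  let ?p = "Poly_Mapping.lookup p" and ?q = "Poly_Mapping.lookup q"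
  have word: "(u + v = 0) \<longleftrightarrow> u = 0 \<and> v = 0" for u v :: "'x free_word"
    by (cases u; cases v) (auto simp: zero_free_word_def plus_free_word_def)
  have "p * q = (\<Sum>u\<in>Poly_Mapping.keys p. \<Sum>v\<in>Poly_Mapping.keys q.
      Poly_Mapping.single (u + v) (?p u * ?q v))"
    by (rule mult_eq_sum_single)
  then have "Poly_Mapping.lookup (p * q) 0 =
      (\<Sum>u\<in>Poly_Mapping.keys p. \<Sum>v\<in>Poly_Mapping.keys q.
        (if u = 0 then ?p u else 0) * (if v = 0 then ?q v else 0))"
    by (auto simp: lookup_sum lookup_single when_def word intro!: sum.cong)
  also have "\<dots> = ?p 0 * ?q 0"
    by (simp flip: sum_product add: in_keys_iff)
  finally show ?thesis .
qed

lemma eval_letters_append: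
  "eval_letters \<phi> (u @ v) =
    (if u = [] then eval_letters \<phi> v else if v = [] then eval_letters \<phi> u
     else eval_letters \<phi> u * eval_letters \<phi> v)"
proof (induction \<phi> u rule: eval_letters.induct)
  case (2 \<phi> x)
  then show ?case by (cases v) auto
qed (auto simp: mult.assoc)

lemma eval_letters_cong:
  "(\<And>x. x \<in> set w \<Longrightarrow> \<phi> x = \<psi> x) \<Longrightarrow> eval_letters \<phi> w = eval_letters \<psi> w"
  by (induction \<phi> w rule: eval_letters.induct) auto

context assoc_algebra
begin

lemma snd_eval_poly_superset:
  assumes "finite K" "Poly_Mapping.keys p \<subseteq> K"
  shows "snd (eval_poly scale \<phi> p) =
    (\<Sum>w\<in>K. scale (Poly_Mapping.lookup p w) (eval_letters \<phi> (letters w)))"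
  unfolding eval_poly_def snd_conv using assms
  by (intro sum.mono_neutral_left) (auto simp: in_keys_iff)

lemma eval_poly_zero [simp]: "eval_poly scale \<phi> 0 = (0, 0)"
  by (simp add: eval_poly_def)

lemma eval_poly_add:
  "eval_poly scale \<phi> (p + q) = eval_poly scale \<phi> p + eval_poly scale \<phi> q"
proof (rule prod_eqI)
  let ?K = "Poly_Mapping.keys p \<union> Poly_Mapping.keys q"
  have "Poly_Mapping.keys (p + q) \<subseteq> ?K"
    by (rule keys_add)
  then show "snd (eval_poly scale \<phi> (p + q)) = snd (eval_poly scale \<phi> p + eval_poly scale \<phi> q)"
    by (simp add: snd_eval_poly_superset[where K = ?K] lookup_add scale_left_distrib sum.distrib)
qed (simp add: eval_poly_def lookup_add)

lemma eval_poly_sum: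
  "eval_poly scale \<phi> (\<Sum>i\<in>I. p i) = (\<Sum>i\<in>I. eval_poly scale \<phi> (p i))"
  by (induction I rule: infinite_finite_induct) (simp_all add: eval_poly_add zero_prod_def)

lemma eval_poly_single:
  "eval_poly scale \<phi> (Poly_Mapping.single w c) =
    (if w = 0 then c else 0, scale c (eval_letters \<phi> (letters w)))"
  by (auto simp: eval_poly_def lookup_single)

text \<open>
  Evaluation is multiplicative as a map into the unitization; this is the second component of
  \<open>(s, x) * (t, y) = (s t, s y + t x + x y)\<close>.
\<close>

lemma snd_eval_poly_mult:
  fixes p q :: "('x, 'f) free_poly"
  shows "snd (eval_poly scale \<phi> (p * q)) =
     scale (Poly_Mapping.lookup p 0) (snd (eval_poly scale \<phi> q))
     + scale (Poly_Mapping.lookup q 0) (snd (eval_poly scale \<phi> p))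
     + snd (eval_poly scale \<phi> p) * snd (eval_poly scale \<phi> q)"
proof -
  let ?p = "Poly_Mapping.lookup p" and ?q = "Poly_Mapping.lookup q"
  let ?P = "Poly_Mapping.keys p" and ?Q = "Poly_Mapping.keys q"
  let ?e = "\<lambda>w. eval_letters \<phi> (letters w)"
  have word: "scale (c * d) (?e (u + v)) =
     scale (if u = 0 then c else 0) (scale d (?e v))
     + scale (if v = 0 then d else 0) (scale c (?e u)) + scale c (?e u) * scale d (?e v)"
    for u v :: "'x free_word" and c d
    by (cases u; cases v)
      (auto simp: zero_free_word_def plus_free_word_def eval_letters_append
        scale_mult_left scale_mult_right mult.commute)
  have const: "(\<Sum>u\<in>Poly_Mapping.keys r. if u = 0 then Poly_Mapping.lookup r u else 0)
      = Poly_Mapping.lookup r 0" for r :: "('x, 'f) free_poly"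
    by (simp add: in_keys_iff)
  have "p * q = (\<Sum>u\<in>?P. \<Sum>v\<in>?Q. Poly_Mapping.single (u + v) (?p u * ?q v))"
    by (rule mult_eq_sum_single)
  then have "snd (eval_poly scale \<phi> (p * q)) =
      (\<Sum>u\<in>?P. \<Sum>v\<in>?Q. scale (?p u * ?q v) (?e (u + v)))"
    by (simp add: eval_poly_sum eval_poly_single snd_sum)
  also have "\<dots> = (\<Sum>u\<in>?P. \<Sum>v\<in>?Q. scale (if u = 0 then ?p u else 0) (scale (?q v) (?e v)))
      + (\<Sum>u\<in>?P. \<Sum>v\<in>?Q. scale (if v = 0 then ?q v else 0) (scale (?p u) (?e u)))
      + (\<Sum>u\<in>?P. \<Sum>v\<in>?Q. scale (?p u) (?e u) * scale (?q v) (?e v))"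
    unfolding word sum.distrib by simp
  also have "(\<Sum>u\<in>?P. \<Sum>v\<in>?Q. scale (if u = 0 then ?p u else 0) (scale (?q v) (?e v)))
      = scale (?p 0) (snd (eval_poly scale \<phi> q))"
    unfolding eval_poly_def snd_conv
    by (subst const[symmetric]) (simp only: scale_sum_left, simp only: scale_sum_right)
  also have "(\<Sum>u\<in>?P. \<Sum>v\<in>?Q. scale (if v = 0 then ?q v else 0) (scale (?p u) (?e u)))
      = scale (?q 0) (snd (eval_poly scale \<phi> p))"
    unfolding eval_poly_def snd_conv
    by (subst const[symmetric], subst sum.swap) (simp only: scale_sum_left, simp only: scale_sum_right)
  also have "(\<Sum>u\<in>?P. \<Sum>v\<in>?Q. scale (?p u) (?e u) * scale (?q v) (?e v))
      = snd (eval_poly scale \<phi> p) * snd (eval_poly scale \<phi> q)"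
    by (simp add: eval_poly_def sum_product)
  finally show ?thesis .
qed

lemma eval_poly_cong:
  assumes "\<And>x. x \<in> poly_vars p \<Longrightarrow> \<phi> x = \<psi> x"
  shows "eval_poly scale \<phi> p = eval_poly scale \<psi> p"
proof -
  have "eval_letters \<phi> (letters w) = eval_letters \<psi> (letters w)" if "w \<in> Poly_Mapping.keys p" for w
    using that assms by (intro eval_letters_cong) (auto simp: poly_vars_def)
  then show ?thesis by (simp add: eval_poly_def)
qed

lemma eval_poly_at_zero:
  fixes p :: "('x, 'f) free_poly"
  shows "snd (eval_poly scale (\<lambda>x. 0) p) = 0"
proof -
  have "eval_letters (\<lambda>x. 0 :: 'a) w = 0" for w :: "'x list"
    by (induction "\<lambda>x::'x. 0::'a" w rule: eval_letters.induct) auto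
  then show ?thesis by (simp add: eval_poly_def)
qed

end

section \<open>The standard identity\<close>

definition standard_poly :: "nat \<Rightarrow> (nat, 'f::ring_1) free_poly" where
  "standard_poly n = (\<Sum>\<sigma> | \<sigma> permutes {..<n}.
     Poly_Mapping.single (Word (map \<sigma> [0..<n])) (of_int (sign \<sigma>)))"

lemma standard_poly_nonzero: "standard_poly n \<noteq> (0 :: (nat, 'f::ring_1) free_poly)"
proof -
  have "map \<sigma> [0..<n] = [0..<n] \<longleftrightarrow> \<sigma> = id" if "\<sigma> permutes {..<n}" for \<sigma>
  proof
    assume "map \<sigma> [0..<n] = [0..<n]"
    then have "\<sigma> i = i" if "i < n" for i
      using that by (metis add_0 diff_zero length_upt nth_map nth_upt)
    then show "\<sigma> = id"
      using \<open>\<sigma> permutes {..<n}\<close> by (auto simp: permutes_def fun_eq_iff)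
  qed auto
  then have "Poly_Mapping.lookup (standard_poly n :: (nat, 'f) free_poly) (Word [0..<n]) =
      (\<Sum>\<sigma> | \<sigma> permutes {..<n}. if \<sigma> = id then 1 else 0)"
    unfolding standard_poly_def lookup_sum
    by (intro sum.cong) (auto simp: lookup_single when_def)
  also have "\<dots> = 1"
    by (simp add: finite_permutations permutes_id)
  finally show ?thesis by auto
qed

context assoc_algebra
begin

definition standard_value :: "nat \<Rightarrow> (nat \<Rightarrow> 'a) \<Rightarrow> 'a" where
  "standard_value n \<phi> = (\<Sum>\<sigma> | \<sigma> permutes {..<n}.
     scale (of_int (sign \<sigma>)) (eval_letters \<phi> (map \<sigma> [0..<n])))"

lemma eval_standard_poly:
  "n > 0 \<Longrightarrow> eval_poly scale \<phi> (standard_poly n) = (0, standard_value n \<phi>)"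
  by (simp add: standard_poly_def standard_value_def eval_poly_sum eval_poly_single
      zero_free_word_def prod_eq_iff fst_sum snd_sum)

lemma eval_letters_update_linear:
  assumes "distinct w" "k \<in> set w"
  shows "eval_letters (\<phi>(k := scale c u + v)) w =
    scale c (eval_letters (\<phi>(k := u)) w) + eval_letters (\<phi>(k := v)) w"
  using assms
proof (induction \<phi> w rule: eval_letters.induct)
  case (3 \<phi> x y w)
  have same: "eval_letters (\<phi>(k := a)) (y # w) = eval_letters \<phi> (y # w)" if "x = k" for a
    using 3 that by (intro eval_letters_cong) auto
  show ?case
  proof (cases "x = k")
    case True
    show ?thesis
      by (simp only: eval_letters.simps same[OF True])
        (simp add: True distrib_right scale_mult_left)
  next
    case False
    then have "eval_letters (\<phi>(k := scale c u + v)) (y # w) =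
        scale c (eval_letters (\<phi>(k := u)) (y # w)) + eval_letters (\<phi>(k := v)) (y # w)"
      by (intro "3.IH") (use 3 in auto)
    then show ?thesis
      by (simp only: eval_letters.simps fun_upd_other[OF False] distrib_left scale_mult_right)
  qed
qed auto

lemma standard_value_linear:
  assumes "k < n"
  shows "standard_value n (\<phi>(k := scale c u + v)) =
    scale c (standard_value n (\<phi>(k := u))) + standard_value n (\<phi>(k := v))"
proof -
  have "eval_letters (\<phi>(k := scale c u + v)) (map \<sigma> [0..<n]) =
    scale c (eval_letters (\<phi>(k := u)) (map \<sigma> [0..<n])) + eval_letters (\<phi>(k := v)) (map \<sigma> [0..<n])"
    if "\<sigma> permutes {..<n}" for \<sigma>
  proof (rule eval_letters_update_linear)
    show "distinct (map \<sigma> [0..<n])"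
      using permutes_inj[OF that] by (auto simp: distinct_map intro: inj_on_subset)
    show "k \<in> set (map \<sigma> [0..<n])"
      using permutes_image[OF that] assms by (simp add: atLeast0LessThan)
  qed
  then have "scale (of_int (sign \<sigma>)) (eval_letters (\<phi>(k := scale c u + v)) (map \<sigma> [0..<n])) =
      scale c (scale (of_int (sign \<sigma>)) (eval_letters (\<phi>(k := u)) (map \<sigma> [0..<n])))
      + scale (of_int (sign \<sigma>)) (eval_letters (\<phi>(k := v)) (map \<sigma> [0..<n]))"
    if "\<sigma> permutes {..<n}" for \<sigma>
    using that by (simp add: scale_right_distrib mult.commute)
  then show ?thesis
    by (simp add: standard_value_def scale_sum_right sum.distrib del: scale_scale)
qed

text \<open>
  Composing each permutation with the transposition of \<open>i\<close> and \<open>j\<close> keeps the product of the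
  substituted elements and flips the sign, so the value equals its own negative.
\<close>

lemma standard_value_alternating:
  assumes "i < n" "j < n" "i \<noteq> j" "\<phi> i = \<phi> j" and two: "(2 :: 'f) \<noteq> 0"
  shows "standard_value n \<phi> = 0"
proof -
  let ?\<tau> = "transpose i j"
  have \<tau>: "?\<tau> permutes {..<n}"
    using assms by (intro permutes_swap_id) auto
  have inv: "\<phi> \<circ> ?\<tau> = \<phi>"
    using assms by (auto simp: fun_eq_iff transpose_def)
  have invol: "?\<tau> \<circ> (?\<tau> \<circ> \<sigma>) = \<sigma>" for \<sigma> :: "nat \<Rightarrow> nat"
    by (simp add: fun_eq_iff)
  have comp: "eval_letters \<phi> (map ?\<tau> w) = eval_letters (\<phi> \<circ> ?\<tau>) w" for w
    by (induction \<phi> w rule: eval_letters.induct) auto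
  have "standard_value n \<phi> = (\<Sum>\<sigma> | \<sigma> permutes {..<n}.
      scale (of_int (sign (?\<tau> \<circ> \<sigma>))) (eval_letters \<phi> (map (?\<tau> \<circ> \<sigma>) [0..<n])))"
    unfolding standard_value_def
    by (rule sum.reindex_bij_witness[of _ "\<lambda>\<sigma>. ?\<tau> \<circ> \<sigma>" "\<lambda>\<sigma>. ?\<tau> \<circ> \<sigma>"])
      (simp_all add: invol permutes_compose[OF _ \<tau>])
  also have "\<dots> = (\<Sum>\<sigma> | \<sigma> permutes {..<n}.
      - scale (of_int (sign \<sigma>)) (eval_letters \<phi> (map \<sigma> [0..<n])))"
  proof (rule sum.cong)
    fix \<sigma> assume "\<sigma> \<in> {\<sigma>. \<sigma> permutes {..<n}}"
    then have "permutation \<sigma>" "permutation ?\<tau>"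
      using \<tau> unfolding permutation_permutes by blast+
    then have "sign (?\<tau> \<circ> \<sigma>) = - sign \<sigma>"
      using \<open>i \<noteq> j\<close> by (simp add: sign_compose sign_swap_id)
    moreover have "eval_letters \<phi> (map (?\<tau> \<circ> \<sigma>) [0..<n]) = eval_letters \<phi> (map \<sigma> [0..<n])"
      using comp[of "map \<sigma> [0..<n]"] unfolding inv by (simp add: comp_def)
    ultimately show "scale (of_int (sign (?\<tau> \<circ> \<sigma>))) (eval_letters \<phi> (map (?\<tau> \<circ> \<sigma>) [0..<n]))
        = - scale (of_int (sign \<sigma>)) (eval_letters \<phi> (map \<sigma> [0..<n]))"
      by simp
  qed simp
  also have "\<dots> = - standard_value n \<phi>"
    by (simp add: standard_value_def sum_negf)
  finally have "scale (1 + 1) (standard_value n \<phi>) = 0"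
    by (simp only: scale_left_distrib scale_one eq_neg_iff_add_eq_0)
  then show ?thesis using two by simp
qed

text \<open>
  More arguments than the dimension are linearly dependent, and a multilinear alternating
  function vanishes on dependent arguments.
\<close>

lemma standard_value_zero:
  assumes "finite B" "span B = UNIV" "card B < n" and two: "(2 :: 'f) \<noteq> 0"
  shows "standard_value n \<phi> = 0"
proof (cases "inj_on \<phi> {..<n}")
  case False
  then show ?thesis
    using standard_value_alternating[OF _ _ _ _ two] by (auto simp: inj_on_def)
next
  case True
  have "dependent (\<phi> ` {..<n})"
    using independent_span_bound[of B "\<phi> ` {..<n}"] assms card_image[OF True] by auto
  then obtain k where k: "k < n" "\<phi> k \<in> span (\<phi> ` {..<n} - {\<phi> k})"
    by (auto simp: dependent_def)
  have lin: "standard_value n (\<phi>(k := scale c u + v)) =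
      scale c (standard_value n (\<phi>(k := u))) + standard_value n (\<phi>(k := v))" for c u v
    by (rule standard_value_linear) fact
  \<comment> \<open>The elements whose insertion in place \<open>k\<close> gives the value \<open>0\<close> form a subspace, and it contains
    the other arguments.\<close>
  from k(2) have "standard_value n (\<phi>(k := \<phi> k)) = 0"
  proof (induction rule: span_induct_alt)
    case base
    show ?case using lin[of 1 0 0] by (simp del: fun_upd_apply)
  next
    case (step c x y)
    then obtain i where "i < n" "i \<noteq> k" "x = \<phi> i" by auto
    then have "standard_value n (\<phi>(k := x)) = 0"
      using k two by (intro standard_value_alternating[of i n k]) auto
    with step show ?case by (simp add: lin del: fun_upd_apply)
  qed
  then show ?thesis by simp
qed

lemma finite_dimensional_imp_PI:
  assumes "finite_dimensional scale" and two: "(2 :: 'f) \<noteq> 0"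
  shows "PI_algebra scale"
proof -
  obtain B where "finite B" "span B = UNIV"
    using assms(1) by (auto simp: finite_dimensional_def)
  then have "eval_poly scale \<phi> (standard_poly (Suc (card B))) = (0, 0)" for \<phi>
    using standard_value_zero[of B "Suc (card B)" \<phi>] two by (simp add: eval_standard_poly)
  then show ?thesis
    unfolding PI_algebra_def using standard_poly_nonzero by blast
qed

end

section \<open>Algebras faithfully graded by matrix patterns\<close>

lemma (in graded_algebra) eval_letters_in_component:
  assumes "\<And>i g. g \<in> carrier G \<Longrightarrow> \<phi> (i, g) \<in> A g"
    and "w \<noteq> []" "set w \<subseteq> UNIV \<times> carrier G"
  shows "eval_letters \<phi> w \<in> A (word_degree G (Word w)) \<and> word_degree G (Word w) \<in> carrier G"
  using assms
proof (induction \<phi> w rule: eval_letters.induct)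
  case (3 \<phi> x y w)
  obtain i g where x: "x = (i, g)" by fastforce
  have IH: "eval_letters \<phi> (y # w) \<in> A (word_degree G (Word (y # w)))"
    "word_degree G (Word (y # w)) \<in> carrier G"
    using "3.IH" "3.prems" by auto
  have "g \<in> carrier G"
    using 3 x by auto
  moreover have "word_degree G (Word (x # y # w)) = g \<otimes> word_degree G (Word (y # w))"
    by (simp add: word_degree_def x)
  ultimately show ?case
    using IH "3.prems"(1)[of g i] x comp_mult by simp
qed (auto simp: word_degree_def)

lemma (in graded_algebra) homogeneous_value_in_component:
  assumes "p \<in> graded_polys G" "homogeneous_poly G p"
  obtains g where "g \<in> carrier G"
    "\<And>\<phi>. (\<And>i g. g \<in> carrier G \<Longrightarrow> \<phi> (i, g) \<in> A g) \<Longrightarrow> snd (eval_poly scale \<phi> p) \<in> A g"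
proof -
  obtain g where g: "g \<in> carrier G" "\<And>w. w \<in> Poly_Mapping.keys p \<Longrightarrow> word_degree G w = g"
    using assms(2) by (auto simp: homogeneous_poly_def)
  have "snd (eval_poly scale \<phi> p) \<in> A g" if \<phi>: "\<And>i g. g \<in> carrier G \<Longrightarrow> \<phi> (i, g) \<in> A g" for \<phi>
    unfolding eval_poly_def snd_conv
  proof (intro subspace_sum[OF comp_subspace[OF g(1)]] subspace_scale[OF comp_subspace[OF g(1)]])
    fix w assume w: "w \<in> Poly_Mapping.keys p"
    show "eval_letters \<phi> (letters w) \<in> A g"
    proof (cases "letters w = []")
      case True
      then show ?thesis using subspace_0[OF comp_subspace[OF g(1)]] by simp
    next
      case False
      moreover have "set (letters w) \<subseteq> UNIV \<times> carrier G"
        using assms(1) w by (auto simp: graded_polys_def poly_vars_def)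
      ultimately show ?thesis
        using eval_letters_in_component[of \<phi> "letters w"] \<phi> g(2)[OF w] by auto
    qed
  qed
  with g(1) show ?thesis using that by blast
qed

text \<open>
  If the unweighted sum vanishes, doubling a single nonzero term makes it nonzero.
\<close>

lemma weighted_sum_nonzero:
  fixes z :: "'i \<Rightarrow> 'f::field_char_0"
  assumes "finite I" "j \<in> I" "z j \<noteq> 0"
  obtains t where "\<And>i. t i \<noteq> 0" "(\<Sum>i\<in>I. z i / t i) \<noteq> 0"
proof (cases "(\<Sum>i\<in>I. z i) = 0")
  case False
  then show ?thesis using that[of "\<lambda>_. 1"] by simp
next
  case True
  define t where "t = (\<lambda>i. if i = j then 1 / 2 else 1 :: 'f)"
  have "(\<Sum>i\<in>I. z i / t i) = (\<Sum>i\<in>I. z i + (if i = j then z j else 0))"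
    by (intro sum.cong) (auto simp: t_def)
  also have "\<dots> = z j"
    using assms(1,2) True by (simp add: sum.distrib)
  finally show ?thesis
    using that[of t] assms(3) by (simp add: t_def)
qed

text \<open>
  The homomorphism \<open>\<rho>\<close> into \<open>m \<times> m\<close> matrices identifies each component \<open>A g\<close> with the matrices
  supported on the pattern \<open>S g\<close>; it need not be injective on the whole algebra, since different
  patterns may overlap.  The last assumption is the symmetry of the patterns that makes the
  algebra verbally prime.
\<close>

locale matrix_graded_algebra = graded_algebra G scale A
  for G :: "('g, 'b) monoid_scheme" (structure)
    and scale :: "'f::field_char_0 \<Rightarrow> 'a::ring \<Rightarrow> 'a"
    and A :: "'g \<Rightarrow> 'a set" +
  fixes m :: nat and S :: "'g \<Rightarrow> (nat \<times> nat) set" and \<rho> :: "'a \<Rightarrow> nat \<Rightarrow> nat \<Rightarrow> 'f"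
  assumes \<rho>_add: "\<rho> (x + y) i j = \<rho> x i j + \<rho> y i j"
    and \<rho>_scale: "\<rho> (scale s x) i j = s * \<rho> x i j"
    and \<rho>_mult: "\<lbrakk>i < m; j < m\<rbrakk> \<Longrightarrow> \<rho> (x * y) i j = (\<Sum>k<m. \<rho> x i k * \<rho> y k j)"
    and \<rho>_faithful: "\<lbrakk>g \<in> carrier G; x \<in> A g; \<And>i j. \<lbrakk>i < m; j < m\<rbrakk> \<Longrightarrow> \<rho> x i j = 0\<rbrakk> \<Longrightarrow> x = 0"
    and \<rho>_support: "\<lbrakk>g \<in> carrier G; x \<in> A g; i < m; j < m; \<rho> x i j \<noteq> 0\<rbrakk> \<Longrightarrow> (i, j) \<in> S g"
    and \<rho>_full: "\<lbrakk>g \<in> carrier G; \<And>i j. M i j \<noteq> 0 \<Longrightarrow> (i, j) \<in> S g\<rbrakk> \<Longrightarrow>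
      \<exists>x\<in>A g. \<forall>i<m. \<forall>j<m. \<rho> x i j = M i j"
    and transitive: "\<lbrakk>j < m; k < m\<rbrakk> \<Longrightarrow> \<exists>\<pi>. \<pi> permutes {..<m} \<and> \<pi> j = k \<and>
      (\<forall>g\<in>carrier G. \<forall>i<m. \<forall>i'<m. (i, i') \<in> S g \<longrightarrow> (\<pi> i, \<pi> i') \<in> S g)"
begin

lemma \<rho>_zero [simp]: "\<rho> 0 i j = 0"
  using \<rho>_scale[of 0 0 i j] by simp

lemma \<rho>_sum: "\<rho> (\<Sum>x\<in>I. f x) i j = (\<Sum>x\<in>I. \<rho> (f x) i j)"
  by (induction I rule: infinite_finite_induct) (simp_all add: \<rho>_add)

text \<open>
  The new substitution is the conjugate of the old one by the monomial matrix with permutation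
  \<open>\<pi>\<close> and diagonal part \<open>t\<close>.  The conjugated matrices still fit the patterns, so they come
  from elements of the same components.
\<close>

lemma monomial_conjugate_assignment:
  assumes \<pi>: "\<pi> permutes {..<m}"
    and S: "\<And>g i j. \<lbrakk>g \<in> carrier G; i < m; j < m; (i, j) \<in> S g\<rbrakk> \<Longrightarrow> (\<pi> i, \<pi> j) \<in> S g"
    and \<phi>: "\<And>i g. g \<in> carrier G \<Longrightarrow> \<phi> (i, g) \<in> A g"
  obtains \<psi> where "\<And>i g. g \<in> carrier G \<Longrightarrow> \<psi> (i, g) \<in> A g"
    "\<And>n g i j. \<lbrakk>g \<in> carrier G; i < m; j < m\<rbrakk> \<Longrightarrow>
      \<rho> (\<psi> (n, g)) (\<pi> i) (\<pi> j) = t i / t j * \<rho> (\<phi> (n, g)) i j"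
proof -
  have \<pi>_less: "\<pi> i < m \<longleftrightarrow> i < m" for i
    using permutes_in_image[OF \<pi>, of i] by simp
  have "\<exists>y. g \<in> carrier G \<longrightarrow> y \<in> A g \<and>
      (\<forall>i<m. \<forall>j<m. \<rho> y (\<pi> i) (\<pi> j) = t i / t j * \<rho> (\<phi> (n, g)) i j)" for n g
  proof (cases "g \<in> carrier G")
    case g: True
    define M where "M i j = (if i < m \<and> j < m then t (inv_into UNIV \<pi> i) / t (inv_into UNIV \<pi> j)
        * \<rho> (\<phi> (n, g)) (inv_into UNIV \<pi> i) (inv_into UNIV \<pi> j) else 0)" for i j
    have M_\<pi>: "M (\<pi> i) (\<pi> j) = t i / t j * \<rho> (\<phi> (n, g)) i j" if "i < m" "j < m" for i j
      using that by (simp add: M_def \<pi>_less permutes_inverses[OF \<pi>])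
    have "(i, j) \<in> S g" if "M i j \<noteq> 0" for i j
    proof -
      have ij: "i < m" "j < m" "\<rho> (\<phi> (n, g)) (inv_into UNIV \<pi> i) (inv_into UNIV \<pi> j) \<noteq> 0"
        using that by (auto simp: M_def split: if_splits)
      have less: "inv_into UNIV \<pi> i < m" "inv_into UNIV \<pi> j < m"
        using ij \<pi>_less[of "inv_into UNIV \<pi> i"] \<pi>_less[of "inv_into UNIV \<pi> j"] by (simp_all add: permutes_inverses[OF \<pi>])
      have "(\<pi> (inv_into UNIV \<pi> i), \<pi> (inv_into UNIV \<pi> j)) \<in> S g"
        using S[OF g less \<rho>_support[OF g \<phi>[OF g] less ij(3)]] .
      then show ?thesis by (simp add: permutes_inverses[OF \<pi>])
    qed
    from \<rho>_full[OF g this] obtain y where "y \<in> A g" "\<forall>i<m. \<forall>j<m. \<rho> y i j = M i j"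
      by blast
    then show ?thesis
      using M_\<pi> \<pi>_less by (intro exI[of _ y]) auto
  qed auto
  then have "\<forall>n g. \<exists>y. g \<in> carrier G \<longrightarrow> y \<in> A g \<and>
      (\<forall>i<m. \<forall>j<m. \<rho> y (\<pi> i) (\<pi> j) = t i / t j * \<rho> (\<phi> (n, g)) i j)"
    by blast
  then obtain y where "\<forall>n g. g \<in> carrier G \<longrightarrow> y n g \<in> A g \<and>
      (\<forall>i<m. \<forall>j<m. \<rho> (y n g) (\<pi> i) (\<pi> j) = t i / t j * \<rho> (\<phi> (n, g)) i j)"
    unfolding choice_iff by blast
  then show ?thesis
    by (intro that[of "\<lambda>(n, g). y n g"]) auto
qed

text \<open>
  Conjugation is compatible with products: the factors \<open>t k\<close> of the inner index cancel, and
  \<open>\<pi>\<close> only reorders the sum over that index.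
\<close>

lemma eval_letters_conjugate:
  assumes \<pi>: "\<pi> permutes {..<m}" and t: "\<And>i. t i \<noteq> 0"
    and "\<And>x i j. \<lbrakk>x \<in> set w; i < m; j < m\<rbrakk> \<Longrightarrow>
      \<rho> (\<psi> x) (\<pi> i) (\<pi> j) = t i / t j * \<rho> (\<phi> x) i j"
    and "i < m" "j < m"
  shows "\<rho> (eval_letters \<psi> w) (\<pi> i) (\<pi> j) = t i / t j * \<rho> (eval_letters \<phi> w) i j"
  using assms(3-)
proof (induction \<psi> w arbitrary: i j rule: eval_letters.induct)
  case (3 \<psi> x y w)
  have less: "\<pi> k < m" if "k < m" for k
    using permutes_in_image[OF \<pi>, of k] that by simp
  have "\<rho> (eval_letters \<psi> (x # y # w)) (\<pi> i) (\<pi> j) =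
      (\<Sum>k<m. \<rho> (\<psi> x) (\<pi> i) k * \<rho> (eval_letters \<psi> (y # w)) k (\<pi> j))"
    using 3 less by (simp add: \<rho>_mult)
  also have "\<dots> = (\<Sum>k<m. \<rho> (\<psi> x) (\<pi> i) (\<pi> k) * \<rho> (eval_letters \<psi> (y # w)) (\<pi> k) (\<pi> j))"
    by (rule sum.permute[OF \<pi>, unfolded comp_def])
  also have "\<dots> = (\<Sum>k<m. t i / t j * (\<rho> (\<phi> x) i k * \<rho> (eval_letters \<phi> (y # w)) k j))"
  proof (rule sum.cong)
    fix k assume "k \<in> {..<m}"
    then have "\<rho> (\<psi> x) (\<pi> i) (\<pi> k) = t i / t k * \<rho> (\<phi> x) i k"
      "\<rho> (eval_letters \<psi> (y # w)) (\<pi> k) (\<pi> j) = t k / t j * \<rho> (eval_letters \<phi> (y # w)) k j"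
      using 3 by auto
    then show "\<rho> (\<psi> x) (\<pi> i) (\<pi> k) * \<rho> (eval_letters \<psi> (y # w)) (\<pi> k) (\<pi> j) =
        t i / t j * (\<rho> (\<phi> x) i k * \<rho> (eval_letters \<phi> (y # w)) k j)"
      using t[of k] by (simp add: field_simps)
  qed simp
  also have "\<dots> = t i / t j * \<rho> (eval_letters \<phi> (x # y # w)) i j"
    using 3 by (simp add: \<rho>_mult sum_distrib_left)
  finally show ?case .
qed auto

lemma eval_poly_conjugate:
  assumes p: "p \<in> graded_polys G" and \<pi>: "\<pi> permutes {..<m}" and t: "\<And>i. t i \<noteq> 0"
    and "\<And>n g i j. \<lbrakk>g \<in> carrier G; i < m; j < m\<rbrakk> \<Longrightarrow>
      \<rho> (\<psi> (n, g)) (\<pi> i) (\<pi> j) = t i / t j * \<rho> (\<phi> (n, g)) i j"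
    and "i < m" "j < m"
  shows "\<rho> (snd (eval_poly scale \<psi> p)) (\<pi> i) (\<pi> j) =
    t i / t j * \<rho> (snd (eval_poly scale \<phi> p)) i j"
proof -
  have "\<rho> (eval_letters \<psi> (letters w)) (\<pi> i) (\<pi> j) =
      t i / t j * \<rho> (eval_letters \<phi> (letters w)) i j"
    if "w \<in> Poly_Mapping.keys p" for w
    using p that assms(4-) by (intro eval_letters_conjugate[OF \<pi> t])
      (auto simp: graded_polys_def poly_vars_def)
  then show ?thesis
    by (simp add: eval_poly_def \<rho>_sum \<rho>_scale sum_distrib_left mult.left_commute)
qed

lemma nonzero_value_entry:
  assumes "g \<in> carrier G" "x \<in> A g" "x \<noteq> 0"
  obtains i j where "i < m" "j < m" "\<rho> x i j \<noteq> 0"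
  using \<rho>_faithful[OF assms(1,2)] assms(3) by blast

text \<open>
  The entry of the product at \<open>(\<pi> i0, l0)\<close> is \<open>t i0\<close> times the sum of \<open>z j / t j\<close>, where \<open>z j\<close>
  pairs the \<open>(i0, j)\<close> entry of the old value with the \<open>(\<pi> j, l0)\<close> entry of \<open>b\<close>.  The choice of
  \<open>\<pi>\<close> makes one of the terms nonzero, the choice of \<open>t\<close> makes the sum nonzero.
\<close>

lemma conjugate_value_mult_nonzero:
  assumes p: "p \<in> graded_polys G" "homogeneous_poly G p"
    and \<phi>: "\<And>i g. g \<in> carrier G \<Longrightarrow> \<phi> (i, g) \<in> A g"
    and nz: "snd (eval_poly scale \<phi> p) \<noteq> 0"
    and b: "g \<in> carrier G" "b \<in> A g" "b \<noteq> 0"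
  obtains \<psi> where "\<And>i g. g \<in> carrier G \<Longrightarrow> \<psi> (i, g) \<in> A g"
    "snd (eval_poly scale \<psi> p) * b \<noteq> 0"
proof -
  let ?a = "snd (eval_poly scale \<phi> p)"
  obtain g' where "g' \<in> carrier G" "?a \<in> A g'"
    using homogeneous_value_in_component[OF p] \<phi> by metis
  then obtain i0 j0 where ij: "i0 < m" "j0 < m" "\<rho> ?a i0 j0 \<noteq> 0"
    using nonzero_value_entry nz by blast
  obtain k0 l0 where kl: "k0 < m" "l0 < m" "\<rho> b k0 l0 \<noteq> 0"
    using nonzero_value_entry b by blast
  obtain \<pi> where \<pi>: "\<pi> permutes {..<m}" "\<pi> j0 = k0"
    and S: "\<And>g i i'. \<lbrakk>g \<in> carrier G; i < m; i' < m; (i, i') \<in> S g\<rbrakk> \<Longrightarrow> (\<pi> i, \<pi> i') \<in> S g"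
    using transitive[OF ij(2) kl(1)] by blast
  define z where "z j = \<rho> ?a i0 j * \<rho> b (\<pi> j) l0" for j
  have "z j0 \<noteq> 0"
    using ij kl \<pi>(2) by (simp add: z_def)
  then obtain t where t: "\<And>i. t i \<noteq> 0" and sum: "(\<Sum>j<m. z j / t j) \<noteq> 0"
    using weighted_sum_nonzero[of "{..<m}" j0 z] ij(2) by auto
  obtain \<psi> where \<psi>: "\<And>i g. g \<in> carrier G \<Longrightarrow> \<psi> (i, g) \<in> A g"
    and conj: "\<And>n g i j. \<lbrakk>g \<in> carrier G; i < m; j < m\<rbrakk> \<Longrightarrow>
      \<rho> (\<psi> (n, g)) (\<pi> i) (\<pi> j) = t i / t j * \<rho> (\<phi> (n, g)) i j"
    using monomial_conjugate_assignment[OF \<pi>(1) S \<phi>, of t] by blast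
  let ?a' = "snd (eval_poly scale \<psi> p)"
  have "\<pi> i0 < m"
    using permutes_in_image[OF \<pi>(1), of i0] ij(1) by simp
  then have "\<rho> (?a' * b) (\<pi> i0) l0 = (\<Sum>k<m. \<rho> ?a' (\<pi> i0) k * \<rho> b k l0)"
    using kl(2) by (rule \<rho>_mult)
  also have "\<dots> = (\<Sum>j<m. \<rho> ?a' (\<pi> i0) (\<pi> j) * \<rho> b (\<pi> j) l0)"
    by (rule sum.permute[OF \<pi>(1), unfolded comp_def])
  also have "\<dots> = (\<Sum>j<m. t i0 * (z j / t j))"
    using eval_poly_conjugate[where \<phi> = \<phi> and \<psi> = \<psi> and t = t, OF p(1) \<pi>(1) t conj ij(1)]
    by (intro sum.cong) (simp_all add: z_def)
  also have "\<dots> \<noteq> 0"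
    unfolding sum_distrib_left[symmetric] using t[of i0] sum by simp
  finally have "?a' * b \<noteq> 0" by auto
  with \<psi> show ?thesis using that by blast
qed

lemma product_identity_cases:
  assumes p: "p \<in> graded_polys G" "homogeneous_poly G p"
    and q: "q \<in> graded_polys G" "homogeneous_poly G q"
    and disj: "poly_vars p \<inter> poly_vars q = {}"
    and pq: "p * q \<in> graded_identities G scale A"
  shows "p \<in> graded_identities G scale A \<or> q \<in> graded_identities G scale A"
proof (rule ccontr)
  let ?graded = "\<lambda>\<phi> :: nat \<times> 'g \<Rightarrow> 'a. \<forall>i. \<forall>g\<in>carrier G. \<phi> (i, g) \<in> A g"
  let ?p0 = "Poly_Mapping.lookup p 0" and ?q0 = "Poly_Mapping.lookup q 0"
  let ?v = "\<lambda>\<phi> r. snd (eval_poly scale \<phi> r)"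
  have const: "fst (eval_poly scale \<phi> r) = Poly_Mapping.lookup r 0"
    for \<phi> :: "nat \<times> 'g \<Rightarrow> 'a" and r
    by (simp add: eval_poly_def)
  \<comment> \<open>Disjointness of the variables allows two independent substitutions.\<close>
  have prod: "?p0 * ?q0 = 0"
    "scale ?p0 (?v \<psi> q) + scale ?q0 (?v \<phi> p) + ?v \<phi> p * ?v \<psi> q = 0"
    if "?graded \<phi>" "?graded \<psi>" for \<phi> \<psi>
  proof -
    define \<chi> where "\<chi> x = (if x \<in> poly_vars p then \<phi> x else \<psi> x)" for x
    have "?graded \<chi>" using that by (auto simp: \<chi>_def)
    then have "eval_poly scale \<chi> (p * q) = (0, 0)"
      using pq by (simp add: graded_identities_def)
    moreover have "eval_poly scale \<chi> p = eval_poly scale \<phi> p"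
      by (rule eval_poly_cong) (simp add: \<chi>_def)
    moreover have "eval_poly scale \<chi> q = eval_poly scale \<psi> q"
      by (rule eval_poly_cong) (use disj in \<open>auto simp: \<chi>_def\<close>)
    ultimately show "?p0 * ?q0 = 0"
      "scale ?p0 (?v \<psi> q) + scale ?q0 (?v \<phi> p) + ?v \<phi> p * ?v \<psi> q = 0"
      using const[of \<chi> "p * q"] snd_eval_poly_mult[of \<chi> p q] by (simp_all add: lookup_mult_zero_word)
  qed
  have zero: "?graded (\<lambda>_. 0)"
    using subspace_0[OF comp_subspace] by auto
  have value0: "?v (\<lambda>_. 0) r = 0" for r :: "(nat \<times> 'g, 'f) free_poly"
    by (rule eval_poly_at_zero)
  assume "\<not> ?thesis"
  then obtain \<phi> \<psi> where \<phi>: "?graded \<phi>" "eval_poly scale \<phi> p \<noteq> (0, 0)"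
    and \<psi>: "?graded \<psi>" "eval_poly scale \<psi> q \<noteq> (0, 0)"
    using p(1) q(1) by (auto simp: graded_identities_def)
  have p_nz: "?p0 \<noteq> 0 \<or> ?v \<phi> p \<noteq> 0"
    using \<phi>(2) const[of \<phi> p] by (auto simp: prod_eq_iff)
  have q_nz: "?q0 \<noteq> 0 \<or> ?v \<psi> q \<noteq> 0"
    using \<psi>(2) const[of \<psi> q] by (auto simp: prod_eq_iff)
  consider "?p0 = 0" "?q0 \<noteq> 0" | "?p0 \<noteq> 0" "?q0 = 0" | "?p0 = 0" "?q0 = 0"
    using prod(1)[OF zero zero] by auto
  then show False
  proof cases
    case 1
    \<comment> \<open>Substituting \<open>0\<close> into \<open>q\<close> leaves its constant term.\<close>
    then show False
      using prod(2)[OF \<phi>(1) zero] p_nz by (simp add: value0)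
  next
    case 2
    then show False
      using prod(2)[OF zero \<psi>(1)] q_nz by (simp add: value0)
  next
    case 3
    obtain g where "g \<in> carrier G" "?v \<psi> q \<in> A g"
      using homogeneous_value_in_component[OF q] \<psi>(1) by metis
    moreover have "?v \<phi> p \<noteq> 0" "?v \<psi> q \<noteq> 0"
      using p_nz q_nz 3 by auto
    ultimately obtain \<phi>' where "\<And>i g. g \<in> carrier G \<Longrightarrow> \<phi>' (i, g) \<in> A g"
      and nz: "?v \<phi>' p * ?v \<psi> q \<noteq> 0"
      using conjugate_value_mult_nonzero[OF p, of \<phi> g "?v \<psi> q"] \<phi>(1) by metis
    then have "?graded \<phi>'" by simp
    then show False
      using prod(2)[OF _ \<psi>(1), of \<phi>'] nz 3 by simp
  qed
qed

end

section \<open>Trivial cohomology classes and the augmentation\<close>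

text \<open>
  The trivial class is the set of coboundaries, and a cocycle belongs to its own class.
\<close>

lemma trivial_class_imp_coboundary:
  fixes c :: "'g \<times> 'g \<Rightarrow> 'f::field"
  assumes "c \<in> carrier (cocycles2 K)"
    and "cohomology_class K c = \<one>\<^bsub>cohomology2 K\<^esub>"
  obtains l where "\<And>x. x \<in> carrier K \<Longrightarrow> l x \<noteq> 0"
    "\<And>x y. \<lbrakk>x \<in> carrier K; y \<in> carrier K\<rbrakk> \<Longrightarrow> c (x, y) = l x * l y / l (x \<otimes>\<^bsub>K\<^esub> y)"
proof -
  have ext: "c \<in> extensional (carrier K \<times> carrier K)"
    using assms(1) by (auto simp: cocycles2_def PiE_def)
  have "(\<lambda>(x, y)\<in>carrier K \<times> carrier K. 1 * 1 / 1) \<in> (coboundaries2 K :: ('g \<times> 'g \<Rightarrow> 'f) set)"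
    unfolding coboundaries2_def by (rule CollectI, rule exI[of _ "\<lambda>_. 1"]) simp
  moreover have "(\<lambda>(x, y)\<in>carrier K \<times> carrier K. 1 * 1 / 1) \<otimes>\<^bsub>cocycles2 K\<^esub> c = c"
    using ext by (auto simp: cocycles2_def fun_eq_iff restrict_def extensional_def)
  ultimately have "c \<in> cohomology_class K c"
    unfolding cohomology_class_def r_coset_def by force
  then have "c \<in> coboundaries2 K"
    using assms(2) by (simp add: cohomology2_def FactGroup_def)
  then obtain l where l: "\<forall>x\<in>carrier K. l x \<noteq> 0"
    "c = (\<lambda>(x, y)\<in>carrier K \<times> carrier K. l x * l y / l (x \<otimes>\<^bsub>K\<^esub> y))"
    by (auto simp: coboundaries2_def)
  show ?thesis
    by (rule that[of l]) (use l in auto)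
qed

lemma lookup_tm_scale: "Poly_Mapping.lookup (tm_scale s a) x = s * Poly_Mapping.lookup a x"
  by (simp add: tm_scale_def map.rep_eq when_def)

lemma sum_if_const:
  "(\<Sum>x\<in>X. if P then f x else (0 :: 'a::comm_monoid_add)) = (if P then \<Sum>x\<in>X. f x else 0)"
  by simp

text \<open>
  In the basis \<open>u\<^sub>h / l h\<close>, in which a trivial cocycle becomes constant, this is the augmentation
  of the group algebra applied to each matrix entry.
\<close>

definition augmentation ::
    "('g \<Rightarrow> 'f::field) \<Rightarrow> 'g set \<Rightarrow> ('g \<times> nat \<times> nat \<Rightarrow>\<^sub>0 'f) \<Rightarrow> nat \<Rightarrow> nat \<Rightarrow> 'f" where
  "augmentation l H a i j = (\<Sum>h\<in>H. l h * Poly_Mapping.lookup a (h, i, j))"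

text \<open>
  On basis vectors the claim is \<open>l (h h') * c (h, h') = l h * l h'\<close>; the rest is bilinearity.
\<close>

lemma augmentation_tm_mult:
  fixes G (structure) and c :: "'g \<times> 'g \<Rightarrow> 'f::field"
  assumes H: "finite H" "\<And>h h'. \<lbrakk>h \<in> H; h' \<in> H\<rbrakk> \<Longrightarrow> h \<otimes> h' \<in> H"
    and l: "\<And>h. h \<in> H \<Longrightarrow> l h \<noteq> 0"
    and c: "\<And>h h'. \<lbrakk>h \<in> H; h' \<in> H\<rbrakk> \<Longrightarrow> c (h, h') = l h * l h' / l (h \<otimes> h')"
    and ab: "a \<in> tm_carrier H m" "b \<in> tm_carrier H m"
    and ij: "i < m" "j < m"
  shows "augmentation l H (tm_mult G c a b) i j =
    (\<Sum>k<m. augmentation l H a i k * augmentation l H b k j)"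
proof -
  let ?a = "Poly_Mapping.lookup a" and ?b = "Poly_Mapping.lookup b"
  let ?I = "H \<times> {..<m} \<times> {..<m}"
  let ?s = "\<lambda>(h, i, j) (h', k, n).
    if j = k then Poly_Mapping.single (h \<otimes> h', i, n) (c (h, h') * ?a (h, i, j) * ?b (h', k, n)) else 0"
  have fin: "finite ?I" using H by simp
  \<comment> \<open>Summing over all basis indices instead of the supports makes the sums independent of the
    elements.\<close>
  have inner: "(\<Sum>y\<in>Poly_Mapping.keys b. ?s x y) = (\<Sum>y\<in>?I. ?s x y)" for x
    using fin ab by (intro sum.mono_neutral_left)
      (auto simp: tm_carrier_def in_keys_iff split: prod.splits)
  have "tm_mult G c a b = (\<Sum>x\<in>Poly_Mapping.keys a. \<Sum>y\<in>Poly_Mapping.keys b. ?s x y)"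
    unfolding tm_mult_def by (intro sum.cong refl) (auto split: prod.splits)
  also have "\<dots> = (\<Sum>x\<in>?I. \<Sum>y\<in>?I. ?s x y)"
    unfolding inner using fin ab by (intro sum.mono_neutral_left)
      (auto simp: tm_carrier_def in_keys_iff split: prod.splits intro!: sum.neutral)
  finally have mult: "tm_mult G c a b = (\<Sum>x\<in>?I. \<Sum>y\<in>?I. ?s x y)" .
  have linear: "augmentation l H (\<Sum>x\<in>I. f x) i j = (\<Sum>x\<in>I. augmentation l H (f x) i j)"
    for I :: "('g \<times> nat \<times> nat) set" and f
    unfolding augmentation_def lookup_sum sum_distrib_left by (rule sum.swap)
  have triple: "(\<Sum>x\<in>?I. F x) = (\<Sum>h\<in>H. \<Sum>i<m. \<Sum>j<m. F (h, i, j))" for F :: "_ \<Rightarrow> 'f"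
    by (simp only: sum.cartesian_product')
  have single: "augmentation l H (?s (h, i', k) (h', k', j')) i j =
      (if i' = i then if k' = k then if j' = j then (l h * ?a (h, i, k)) * (l h' * ?b (h', k, j)) else 0 else 0 else 0)"
    if "h \<in> H" "h' \<in> H" for h h' i' k k' j'
  proof -
    have "augmentation l H (Poly_Mapping.single (h \<otimes> h', i, j) s) i j = l (h \<otimes> h') * s" for s
      using H that by (simp add: augmentation_def lookup_single when_def if_distrib[of "(*) _"] cong: if_cong)
    moreover have "augmentation l H (Poly_Mapping.single (h \<otimes> h', i', j') s) i j = 0"
      if "i' \<noteq> i \<or> j' \<noteq> j" for s
      using that by (auto simp: augmentation_def lookup_single when_def intro!: sum.neutral)
    moreover have "augmentation l H 0 i j = 0"
      by (simp add: augmentation_def)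
    ultimately show ?thesis
      using that l H(2) by (auto simp: c)
  qed
  have "augmentation l H (tm_mult G c a b) i j =
      (\<Sum>h\<in>H. \<Sum>i'<m. \<Sum>k<m. \<Sum>h'\<in>H. \<Sum>k'<m. \<Sum>j'<m.
        augmentation l H (?s (h, i', k) (h', k', j')) i j)"
    unfolding mult linear triple ..
  also have "\<dots> = (\<Sum>h\<in>H. \<Sum>i'<m. \<Sum>k<m. \<Sum>h'\<in>H. \<Sum>k'<m. \<Sum>j'<m.
      (if i' = i then if k' = k then if j' = j then (l h * ?a (h, i, k)) * (l h' * ?b (h', k, j)) else 0 else 0 else 0))"
    by (intro sum.cong refl single)
  also have "\<dots> = (\<Sum>h\<in>H. \<Sum>k<m. \<Sum>h'\<in>H. (l h * ?a (h, i, k)) * (l h' * ?b (h', k, j)))"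
  proof (rule sum.cong)
    fix h assume "h \<in> H"
    show "(\<Sum>i'<m. \<Sum>k<m. \<Sum>h'\<in>H. \<Sum>k'<m. \<Sum>j'<m.
        (if i' = i then if k' = k then if j' = j then (l h * ?a (h, i, k)) * (l h' * ?b (h', k, j)) else 0 else 0 else 0))
      = (\<Sum>k<m. \<Sum>h'\<in>H. (l h * ?a (h, i, k)) * (l h' * ?b (h', k, j)))"
      using ij by (simp add: sum_if_const)
  qed simp
  also have "\<dots> = (\<Sum>k<m. augmentation l H a i k * augmentation l H b k j)"
    unfolding augmentation_def sum_product by (rule sum.swap)
  finally show ?thesis .
qed

text \<open>
  Only one group element can contribute to an entry of a homogeneous element.  This is why
  the augmentation loses no information within a component.
\<close>

lemma augmentation_homogeneous:
  fixes G (structure)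
  assumes "group G" "finite H" "H \<subseteq> carrier G" "set gs \<subseteq> carrier G" "g \<in> carrier G"
    and a: "a \<in> tm_component G H gs g" and ij: "i < length gs" "j < length gs"
  shows "augmentation l H a i j =
      (let h = gs ! i \<otimes> g \<otimes> inv (gs ! j)
       in if h \<in> H then l h * Poly_Mapping.lookup a (h, i, j) else 0)"
proof -
  interpret group G by fact
  define h where "h = gs ! i \<otimes> g \<otimes> inv (gs ! j)"
  have gs: "gs ! i \<in> carrier G" "gs ! j \<in> carrier G"
    using assms(4) ij by auto
  have zero: "Poly_Mapping.lookup a (h', i, j) = 0" if "h' \<in> H" "h' \<noteq> h" for h'
  proof (rule ccontr)
    assume "Poly_Mapping.lookup a (h', i, j) \<noteq> 0"
    then have "(h', i, j) \<in> Poly_Mapping.keys a"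
      by (simp add: in_keys_iff)
    then have "g = inv (gs ! i) \<otimes> h' \<otimes> gs ! j"
      using a by (auto simp: tm_component_def)
    moreover have "h' \<in> carrier G" using that assms(3) by auto
    ultimately have "h = h'"
      using gs by (simp add: h_def m_assoc[symmetric]) (simp add: m_assoc)
    with that show False by simp
  qed
  have "augmentation l H a i j =
      (\<Sum>h'\<in>H. if h' = h then l h * Poly_Mapping.lookup a (h, i, j) else 0)"
    unfolding augmentation_def using zero by (intro sum.cong) auto
  also have "\<dots> = (if h \<in> H then l h * Poly_Mapping.lookup a (h, i, j) else 0)"
    using assms(2) by simp
  finally show ?thesis by (simp add: h_def Let_def)
qed

section \<open>Translation of cosets\<close>

text \<open>
  Equal fibre sizes give some permutation carrying \<open>v\<close> to \<open>u\<close>; following it by a transposition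
  inside one fibre of \<open>u\<close> arranges the value at \<open>j\<close>.
\<close>

lemma equal_fibres_permutation:
  fixes u v :: "nat \<Rightarrow> 'c"
  assumes "\<And>C. card {i. i < m \<and> u i = C} = card {i. i < m \<and> v i = C}"
    and jk: "j < m" "k < m" "v j = u k"
  obtains \<pi> where "\<pi> permutes {..<m}" "\<pi> j = k" "\<And>i. i < m \<Longrightarrow> u (\<pi> i) = v i"
proof -
  have "count (image_mset v (mset_set {..<m})) C = count (image_mset u (mset_set {..<m})) C" for C
    using assms(1)[of C] by (simp add: count_image_mset_eq_card_vimage Collect_conj_eq lessThan_def eq_commute)
  then have "image_mset v (mset_set {..<m}) = image_mset u (mset_set {..<m})"
    by (rule multiset_eqI)
  then obtain p where p: "p permutes {..<m}" "\<forall>i\<in>{..<m}. v i = u (p i)"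
    using image_mset_eq_implies_permutes[of "{..<m}" v u] by auto
  let ?\<tau> = "transpose (p j) k"
  have "p j < m" using permutes_in_image[OF p(1), of j] jk by simp
  then have "?\<tau> \<circ> p permutes {..<m}"
    using p(1) jk by (intro permutes_compose permutes_swap_id) auto
  moreover have "u (?\<tau> x) = u x" for x
    using p jk by (auto simp: transpose_def)
  ultimately show ?thesis
    using that[of "?\<tau> \<circ> p"] p by simp
qed

text \<open>
  The permutation realises left translation of cosets by \<open>d = g\<^sub>k g\<^sub>j\<^sup>-\<^sup>1\<close>, which moves the coset
  of \<open>g\<^sub>j\<close> to that of \<open>g\<^sub>k\<close>.  It maps \<open>g\<^sub>i g g\<^sub>i\<^sub>'\<^sup>-\<^sup>1\<close> to its conjugate by \<open>d\<close>, up to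
  factors from \<open>H\<close> on both sides, so normality keeps it in \<open>H\<close>.
\<close>

lemma coset_permutation:
  fixes G (structure)
  assumes H: "H \<lhd> G" and gs: "set gs \<subseteq> carrier G"
    and eq: "cosets_equally_represented G H gs"
    and jk: "j < length gs" "k < length gs"
  obtains \<pi> where "\<pi> permutes {..<length gs}" "\<pi> j = k"
    "\<And>g i i'. \<lbrakk>g \<in> carrier G; i < length gs; i' < length gs;
      gs ! i \<otimes> g \<otimes> inv (gs ! i') \<in> H\<rbrakk> \<Longrightarrow> gs ! \<pi> i \<otimes> g \<otimes> inv (gs ! \<pi> i') \<in> H"
proof -
  interpret normal H G by fact
  have sub: "subgroup H G" by (rule subgroup_axioms)
  have gsc [simp]: "gs ! i \<in> carrier G" if "i < length gs" for i
    using gs that by auto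
  define d where "d = gs ! k \<otimes> inv (gs ! j)"
  have d [simp]: "d \<in> carrier G" using jk by (simp add: d_def)
  have coset_eq: "H #> x = H #> y \<longleftrightarrow> x \<otimes> inv y \<in> H" if "x \<in> carrier G" "y \<in> carrier G" for x y
    using rcos_module[OF is_group that(2,1)] repr_independence[OF _ that(2) sub]
      rcos_self[OF that(1) sub] by metis
  let ?u = "\<lambda>i. H #> gs ! i" and ?v = "\<lambda>i. H #> (d \<otimes> gs ! i)"
  have translate: "H #> (d \<otimes> x) = H #> y \<longleftrightarrow> H #> x = H #> (inv d \<otimes> y)"
    if [simp]: "x \<in> carrier G" "y \<in> carrier G" for x y
  proof -
    have "inv d \<otimes> (d \<otimes> x \<otimes> inv y) \<otimes> d = x \<otimes> inv (inv d \<otimes> y)"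
      by (simp add: m_assoc inv_mult_group) (simp flip: m_assoc)
    moreover have "d \<otimes> (x \<otimes> inv (inv d \<otimes> y)) \<otimes> inv d = d \<otimes> x \<otimes> inv y"
      by (simp add: m_assoc inv_mult_group)
    ultimately show ?thesis
      using inv_op_closed1[of d "d \<otimes> x \<otimes> inv y"] inv_op_closed2[of d "x \<otimes> inv (inv d \<otimes> y)"]
      by (auto simp: coset_eq)
  qed
  have mem: "gs ! i \<in> H #> x \<longleftrightarrow> ?u i = H #> x" if "i < length gs" "x \<in> carrier G" for i x
    using that rcos_module[OF is_group that(2), of "gs ! i"] coset_eq[of "gs ! i" x] by simp
  have fibre: "card {i. i < length gs \<and> ?u i = C} = card {i. i < length gs \<and> ?v i = C}" for C
  proof (cases "C \<in> rcosets H")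
    case True
    then obtain x where x: "x \<in> carrier G" "C = H #> x"
      by (auto simp: RCOSETS_def)
    have shift: "?v i = C \<longleftrightarrow> gs ! i \<in> H #> (inv d \<otimes> x)" if "i < length gs" for i
      using mem[OF that, of "inv d \<otimes> x"] translate[OF gsc[OF that] x(1)] x by simp
    have u: "{i. i < length gs \<and> ?u i = C} = {i. i < length gs \<and> gs ! i \<in> H #> x}"
      using x mem by auto
    have v: "{i. i < length gs \<and> ?v i = C} = {i. i < length gs \<and> gs ! i \<in> H #> (inv d \<otimes> x)}"
      by (intro Collect_cong conj_cong refl shift)
    have cosets: "H #> x \<in> rcosets H" "H #> (inv d \<otimes> x) \<in> rcosets H"
      using x by (auto simp: RCOSETS_def)
    show ?thesis
      unfolding u v
      by (rule eq[unfolded cosets_equally_represented_def, THEN bspec, THEN bspec, OF cosets])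
  next
    case False
    have "H #> y \<noteq> C" if "y \<in> carrier G" for y
      using False that by (auto simp: RCOSETS_def)
    then have "?u i \<noteq> C" "?v i \<noteq> C" if "i < length gs" for i
      using that by simp_all
    then have "{i. i < length gs \<and> ?u i = C} = {}" "{i. i < length gs \<and> ?v i = C} = {}"
      by blast+
    then show ?thesis by (simp only:)
  qed
  have "?v j = ?u k"
    using jk by (simp add: d_def m_assoc)
  then obtain \<pi> where \<pi>: "\<pi> permutes {..<length gs}" "\<pi> j = k"
    and coset: "\<And>i. i < length gs \<Longrightarrow> ?u (\<pi> i) = ?v i"
    using equal_fibres_permutation[of "length gs" ?u ?v j k] fibre jk by blast
  have less: "\<pi> i < length gs" if "i < length gs" for i
    using permutes_in_image[OF \<pi>(1), of i] that by simp
  have "gs ! \<pi> i \<otimes> g \<otimes> inv (gs ! \<pi> i') \<in> H"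
    if g [simp]: "g \<in> carrier G" and [simp]: "i < length gs" "i' < length gs"
      and mem: "gs ! i \<otimes> g \<otimes> inv (gs ! i') \<in> H" for g i i'
  proof -
    define x y where "x = gs ! \<pi> i \<otimes> inv (d \<otimes> gs ! i)" and "y = gs ! \<pi> i' \<otimes> inv (d \<otimes> gs ! i')"
    have xy: "x \<in> H" "y \<in> H"
      using coset[of i] coset[of i'] less[of i] less[of i'] by (simp_all add: x_def y_def coset_eq)
    have "gs ! \<pi> i = x \<otimes> (d \<otimes> gs ! i)" "gs ! \<pi> i' = y \<otimes> (d \<otimes> gs ! i')"
      using less[of i] less[of i'] by (simp_all add: x_def y_def m_assoc)
    then have "gs ! \<pi> i \<otimes> g \<otimes> inv (gs ! \<pi> i') =
        x \<otimes> (d \<otimes> (gs ! i \<otimes> g \<otimes> inv (gs ! i')) \<otimes> inv d) \<otimes> inv y"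
      using xy by (simp add: m_assoc inv_mult_group)
    also have "\<dots> \<in> H"
      using xy inv_op_closed2[OF d mem] by simp
    finally show ?thesis .
  qed
  with \<pi> show ?thesis using that by blast
qed

section \<open>Strong verbal primeness\<close>

theorem corollary1p9:
  fixes G :: "('g, 'b) monoid_scheme"
    and scale :: "'f::{alg_closed_field, field_char_0} \<Rightarrow> 'a::ring \<Rightarrow> 'a"
    and A :: "'g \<Rightarrow> 'a set"
    and H :: "'g set"
    and \<alpha> :: "('g \<times> 'g \<Rightarrow> 'f) set"
    and gs :: "'g list"
  assumes "graded_algebra G scale A"
    and "finite (carrier G)"
    and "finite_dimensional scale"
    and "graded_simple G scale A"
    and "presentation G scale A H \<alpha> gs"
    and "H \<lhd> G"
    and "cosets_equally_represented G H gs"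
    and "\<alpha> = \<one>\<^bsub>cohomology2 (G\<lparr>carrier := H\<rparr>)\<^esub>"
  shows "graded_strongly_verbally_prime G scale A"
proof -
  interpret graded_algebra G scale A by fact
  let ?K = "G\<lparr>carrier := H\<rparr>" and ?m = "length gs"
  obtain c \<theta> where sub: "subgroup H G" and gs: "set gs \<subseteq> carrier G"
    and c: "c \<in> carrier (cocycles2 ?K)" "\<alpha> = cohomology_class ?K c"
    and \<theta>: "graded_iso_tm G scale A H c gs \<theta>"
    using assms(5) by (auto simp: presentation_def)
  obtain l where l: "\<And>h. h \<in> H \<Longrightarrow> l h \<noteq> 0"
    and cl: "\<And>h h'. \<lbrakk>h \<in> H; h' \<in> H\<rbrakk> \<Longrightarrow> c (h, h') = l h * l h' / l (h \<otimes>\<^bsub>G\<^esub> h')"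
    using trivial_class_imp_coboundary[OF c(1)] c(2) assms(8) by (auto simp del: One_nat_def)
  have H: "H \<subseteq> carrier G" "finite H"
    using subgroup.subset[OF sub] finite_subset[OF _ assms(2)] by auto
  interpret \<theta>: Vector_Spaces.linear scale tm_scale \<theta>
    using \<theta> by (simp add: graded_iso_tm_def)
  have bij: "bij_betw \<theta> UNIV (tm_carrier H ?m)"
    and mult: "\<And>x y. \<theta> (x * y) = tm_mult G c (\<theta> x) (\<theta> y)"
    and comp: "\<And>g. g \<in> carrier G \<Longrightarrow> \<theta> ` A g = tm_component G H gs g"
    using \<theta> by (auto simp: graded_iso_tm_def)
  have \<theta>_carrier: "\<theta> x \<in> tm_carrier H ?m" for x
    using bij by (auto simp: bij_betw_def)
  define \<rho> where "\<rho> x = augmentation l H (\<theta> x)" for x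
  define S where "S g = {(i, j). i < ?m \<and> j < ?m \<and> gs ! i \<otimes>\<^bsub>G\<^esub> g \<otimes>\<^bsub>G\<^esub> inv\<^bsub>G\<^esub> (gs ! j) \<in> H}" for g
  have \<rho>_homogeneous: "\<rho> x i j = (let h = gs ! i \<otimes>\<^bsub>G\<^esub> g \<otimes>\<^bsub>G\<^esub> inv\<^bsub>G\<^esub> (gs ! j)
       in if h \<in> H then l h * Poly_Mapping.lookup (\<theta> x) (h, i, j) else 0)"
    if "g \<in> carrier G" "x \<in> A g" "i < ?m" "j < ?m" for x g i j
    unfolding \<rho>_def using that comp[of g]
    by (intro augmentation_homogeneous[OF is_group H(2,1) gs]) auto
  \<comment> \<open>Up to the nonzero factors \<open>l h\<close>, the entries of \<open>\<rho> x\<close> for \<open>x \<in> A g\<close> are the coordinates of \<open>x\<close>.\<close>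
  interpret matrix_graded_algebra G scale A ?m S \<rho>
  proof
    show "\<rho> (x + y) i j = \<rho> x i j + \<rho> y i j" for x y i j
      by (simp add: \<rho>_def augmentation_def \<theta>.add lookup_add distrib_left sum.distrib)
    show "\<rho> (scale s x) i j = s * \<rho> x i j" for s x i j
      by (simp add: \<rho>_def augmentation_def \<theta>.scale lookup_tm_scale
          sum_distrib_left mult.left_commute)
    show "\<rho> (x * y) i j = (\<Sum>k<?m. \<rho> x i k * \<rho> y k j)" if "i < ?m" "j < ?m" for x y i j
      unfolding \<rho>_def mult
      by (rule augmentation_tm_mult[OF H(2) _ l cl \<theta>_carrier \<theta>_carrier that])
        (auto intro: subgroup.m_closed[OF sub])
    show "x = 0"
      if g: "g \<in> carrier G" and x: "x \<in> A g" and zero: "\<And>i j. \<lbrakk>i < ?m; j < ?m\<rbrakk> \<Longrightarrow> \<rho> x i j = 0"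
      for g x
    proof -
      have "\<theta> x \<in> tm_component G H gs g"
        using comp[OF g] x by auto
      have "Poly_Mapping.keys (\<theta> x) = {}"
      proof (rule ccontr)
        assume "Poly_Mapping.keys (\<theta> x) \<noteq> {}"
        then obtain h i j where key: "(h, i, j) \<in> Poly_Mapping.keys (\<theta> x)"
          by (metis ex_in_conv prod_cases3)
        then have hij: "h \<in> H" "i < ?m" "j < ?m" "g = inv\<^bsub>G\<^esub> (gs ! i) \<otimes>\<^bsub>G\<^esub> h \<otimes>\<^bsub>G\<^esub> gs ! j"
          using \<open>\<theta> x \<in> tm_component G H gs g\<close> by (auto simp: tm_component_def tm_carrier_def)
        moreover have "gs ! i \<in> carrier G" "gs ! j \<in> carrier G" "h \<in> carrier G"
          using hij gs H by auto
        ultimately have "gs ! i \<otimes>\<^bsub>G\<^esub> g \<otimes>\<^bsub>G\<^esub> inv\<^bsub>G\<^esub> (gs ! j) = h"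
          by (simp add: m_assoc[symmetric]) (simp add: m_assoc)
        then have "l h * Poly_Mapping.lookup (\<theta> x) (h, i, j) = 0"
          using \<rho>_homogeneous[OF g x hij(2,3)] zero[OF hij(2,3)] hij(1) by simp
        then show False
          using l[OF hij(1)] key by (simp add: in_keys_iff)
      qed
      then have "\<theta> x = \<theta> 0" by (simp add: \<theta>.zero)
      then show "x = 0"
        using bij by (auto simp: bij_betw_def inj_on_def)
    qed
    show "(i, j) \<in> S g"
      if "g \<in> carrier G" "x \<in> A g" "i < ?m" "j < ?m" "\<rho> x i j \<noteq> 0" for g x i j
      using \<rho>_homogeneous[OF that(1-4)] that(3-) by (auto simp: S_def Let_def split: if_splits)
    show "\<exists>x\<in>A g. \<forall>i<?m. \<forall>j<?m. \<rho> x i j = M i j"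
      if g: "g \<in> carrier G" and M: "\<And>i j. M i j \<noteq> 0 \<Longrightarrow> (i, j) \<in> S g" for g M
    proof -
      let ?h = "\<lambda>i j. gs ! i \<otimes>\<^bsub>G\<^esub> g \<otimes>\<^bsub>G\<^esub> inv\<^bsub>G\<^esub> (gs ! j)"
      define f where "f = (\<lambda>(h, i, j). if h = ?h i j then M i j / l h else 0)"
      have supp: "{x. f x \<noteq> 0} \<subseteq> H \<times> {..<?m} \<times> {..<?m}"
        using M by (auto simp: f_def S_def split: if_splits)
      then have "finite {x. f x \<noteq> 0}"
        by (rule finite_subset) (use H in simp)
      then obtain a where a: "Poly_Mapping.lookup a = f"
        by (metis Abs_poly_mapping_inverse mem_Collect_eq)
      have "g = inv\<^bsub>G\<^esub> (gs ! i) \<otimes>\<^bsub>G\<^esub> ?h i j \<otimes>\<^bsub>G\<^esub> gs ! j" if "i < ?m" "j < ?m" for i j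
      proof -
        have "gs ! i \<in> carrier G" "gs ! j \<in> carrier G" using that gs by auto
        then show ?thesis using g
          by (simp add: m_assoc[symmetric]) (simp add: m_assoc)
      qed
      then have "a \<in> tm_component G H gs g"
        using M by (fastforce simp: tm_component_def tm_carrier_def in_keys_iff a f_def S_def split: if_splits)
      then obtain x where x: "x \<in> A g" "\<theta> x = a"
        using comp[OF g] by (metis imageE)
      have "\<rho> x i j = M i j" if "i < ?m" "j < ?m" for i j
        using \<rho>_homogeneous[OF g x(1) that] M[of i j] l[of "?h i j"]
        by (auto simp: x(2) a f_def S_def Let_def split: if_splits)
      with x(1) show ?thesis by blast
    qed
    show "\<exists>\<pi>. \<pi> permutes {..<?m} \<and> \<pi> j = k \<and>
        (\<forall>g\<in>carrier G. \<forall>i<?m. \<forall>i'<?m. (i, i') \<in> S g \<longrightarrow> (\<pi> i, \<pi> i') \<in> S g)"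
      if jk: "j < ?m" "k < ?m" for j k
    proof -
      obtain \<pi> where \<pi>: "\<pi> permutes {..<?m}" "\<pi> j = k"
        and S: "\<And>g i i'. \<lbrakk>g \<in> carrier G; i < ?m; i' < ?m;
          gs ! i \<otimes>\<^bsub>G\<^esub> g \<otimes>\<^bsub>G\<^esub> inv\<^bsub>G\<^esub> (gs ! i') \<in> H\<rbrakk> \<Longrightarrow> gs ! \<pi> i \<otimes>\<^bsub>G\<^esub> g \<otimes>\<^bsub>G\<^esub> inv\<^bsub>G\<^esub> (gs ! \<pi> i') \<in> H"
        using coset_permutation[OF assms(6) gs assms(7) jk] by blast
      have "\<pi> i < ?m" if "i < ?m" for i
        using permutes_in_image[OF \<pi>(1), of i] that by simp
      with \<pi> S show ?thesis
        by (intro exI[of _ \<pi>]) (auto simp: S_def)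
    qed
  qed
  have "PI_algebra scale"
    using assms(3) by (rule finite_dimensional_imp_PI) simp
  then show ?thesis
    unfolding graded_strongly_verbally_prime_def using product_identity_cases by blast
qed

end
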